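(* Let $q>1$, $1\le k\le n-1$, and let $$P=\frac{1}{[n]_q}I+\frac{q[n-1]_q}{[n]_q\sum_{l=1}^{k}[n-l]_q}\sum_{l=1}^{k}J_{n+1-l}(q)\in\mathcal H_q(S_n).$$ For $\lambda\vdash n$ and $S\in\mathrm{SYT}(\lambda)$, the eigenvalue of $P$ indexed by $S$ is $$\mathrm{eig}_q(S)=\frac{1}{[n]_q}+\frac{q[n-1]_q}{[n]_q\sum_{l=1}^{k}[n-l]_q}\sum_{l=1}^{k}\big[c_{n+1-l}(S)\big]_q .$$ For a partition $\nu$ put $\mathrm{Diag}_q(\nu)=\sum_{(i,j)\in\nu}[j-i]_q$. Then the same eigenvalues can be indexed by pairs $(\lambda,\mu)$ with $\lambda\vdash n$, $\mu\vdash n-k$, $\mu\subseteq\lambda$ (a tableau $S\in\mathrm{SYT}(\lambda)$ being assigned the pair $(\lambda,\mu)$, where $\mu$ is the shape formed by the boxes of $S$ containing $1,\dots,n-k$), and are given by $$\mathrm{eig}_q(\lambda,\mu)=\frac{1}{[n]_q}+\frac{q[n-1]_q}{[n]_q\sum_{l=1}^{k}[n-l]_q}\bigl(\mathrm{Diag}_q(\lambda)-\mathrm{Diag}_q(\mu)\bigr).$$ The eigenvalue corresponding to $(\lambda,\mu)$ has multiplicity $d_\mu d_{\lambda/\mu}$ (in the irreducible module $S_q^\lambda$).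
   Context: For $r\in\mathbb Z$, $[r]_q=\frac{q^r-1}{q-1}$. $\mathcal H_q(S_n)$ is the complex associative unital algebra (unit $I$) generated by $T_{s_1},\dots,T_{s_{n-1}}$, $s_i=(i\ i+1)$, with relations $T_{s_i}^2=(q-1)T_{s_i}+q$, $T_{s_i}T_{s_j}=T_{s_j}T_{s_i}$ for $|i-j|\ge2$, $T_{s_i}T_{s_{i+1}}T_{s_i}=T_{s_{i+1}}T_{s_i}T_{s_{i+1}}$. For a reduced expression $w=s_{i_1}\cdots s_{i_r}$, $T_w=T_{s_{i_1}}\cdots T_{s_{i_r}}$. The Jucys--Murphy elements are $J_m(q)=\sum_{i=1}^{m-1}q^{i-m}T_{(i\,m)}$, $2\le m\le n$, where $(i\,m)$ is the transposition of $i$ and $m$. $\mathrm{SYT}(\lambda)$ is the set of standard Young tableaux of shape $\lambda$, $d_\lambda=|\mathrm{SYT}(\lambda)|$, and $d_{\lambda/\mu}$ is the number of standard fillings of the skew shape $\lambda/\mu$. Partitions are identified with their Young diagrams, whose boxes are (row, column) pairs $(i,j)$. If $m$ lies in box $(i_m(S),j_m(S))$ of $S$, then $c_m(S)=j_m(S)-i_m(S)$. The irreducible $\mathcal H_q(S_n)$-modules $S_q^\lambda$ are indexed by $\lambda\vdash n$; $S_q^\lambda$ has dimension $d_\lambda$ and a (seminormal) basis $\{v_S:S\in\mathrm{SYT}(\lambda)\}$ with $J_m(q)v_S=[c_m(S)]_q\,v_S$ for $2\le m\le n$. "The eigenvalue of $P$ indexed by $S$" means the eigenvalue of $P$ acting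 on $S_q^\lambda$ at the eigenvector $v_S$. Multiplicities are counted by tableaux $S$, i.e. the multiplicity of $(\lambda,\mu)$ is the number of basis vectors $v_S$ of $S_q^\lambda$ whose tableau is assigned $(\lambda,\mu)$. *)

theory Defs
  imports
    Complex_Main
    "HOL-Library.Poly_Mapping"
    "HOL-Combinatorics.Transposition"
    "HOL-Algebra.QuotRing"
begin

definition qint :: "real \<Rightarrow> int \<Rightarrow> real"
  where "qint q r = (q powi r - 1) / (q - 1)"


subsection \<open>Free algebras\<close>

text \<open>A copy of \<^typ>\<open>nat list\<close> that carries concatenation as its (non-commutative) monoid
  operation, so that the finitely supported functions from it to the complex numbers, with the
  convolution product of \<^theory>\<open>HOL-Library.Poly_Mapping\<close>, form the free associative unital
  algebra on generators indexed by the natural numbers.\<close>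

datatype word = Word (letters: "nat list")

instantiation word :: monoid_add
begin

definition zero_word :: word
  where "zero_word = Word []"

definition plus_word :: "word \<Rightarrow> word \<Rightarrow> word"
  where "plus_word u v = Word (letters u @ letters v)"

instance
  by standard (simp_all add: zero_word_def plus_word_def)

end

type_synonym free_elem = "word \<Rightarrow>\<^sub>0 complex"

text \<open>The free algebra on the generators \<open>1, \<dots>, n - 1\<close>.\<close>

definition free_alg :: "nat \<Rightarrow> free_elem ring"
  where "free_alg n =
    \<lparr>carrier = {f. \<forall>w\<in>Poly_Mapping.keys f. set (letters w) \<subseteq> {1..<n}},
     mult = (*), one = 1, zero = 0, add = (+)\<rparr>"

definition free_gen :: "nat \<Rightarrow> free_elem"
  where "free_gen i = Poly_Mapping.single (Word [i]) 1"

definition free_scalar :: "complex \<Rightarrow> free_elem"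
  where "free_scalar c = Poly_Mapping.single 0 c"


subsection \<open>The Hecke algebra of the symmetric group\<close>

definition hecke_relators :: "nat \<Rightarrow> real \<Rightarrow> free_elem set"
  where "hecke_relators n q =
    {free_gen i * free_gen i
       - (free_scalar (of_real (q - 1)) * free_gen i + free_scalar (of_real q))
     | i. i \<in> {1..<n}}
    \<union> {free_gen i * free_gen j - free_gen j * free_gen i
     | i j. i \<in> {1..<n} \<and> j \<in> {1..<n} \<and> \<bar>int i - int j\<bar> \<ge> 2}
    \<union> {free_gen i * free_gen (i + 1) * free_gen i
       - free_gen (i + 1) * free_gen i * free_gen (i + 1)
     | i. i \<in> {1..<n} \<and> i + 1 \<in> {1..<n}}"

definition hecke_ideal :: "nat \<Rightarrow> real \<Rightarrow> free_elem set"
  where "hecke_ideal n q = genideal (free_alg n) (hecke_relators n q)"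

definition hecke :: "nat \<Rightarrow> real \<Rightarrow> free_elem set ring"
  where "hecke n q = free_alg n Quot hecke_ideal n q"

definition hecke_class :: "nat \<Rightarrow> real \<Rightarrow> free_elem \<Rightarrow> free_elem set"
  where "hecke_class n q f = hecke_ideal n q +>\<^bsub>free_alg n\<^esub> f"

definition hecke_smult :: "nat \<Rightarrow> real \<Rightarrow> complex \<Rightarrow> free_elem set \<Rightarrow> free_elem set"
  where "hecke_smult n q c h = hecke_class n q (free_scalar c) \<otimes>\<^bsub>hecke n q\<^esub> h"

text \<open>\<open>hecke_gen n q i\<close> is \<open>T\<^sub>s\<close> for \<open>s = (i i+1)\<close>.\<close>

definition hecke_gen :: "nat \<Rightarrow> real \<Rightarrow> nat \<Rightarrow> free_elem set"
  where "hecke_gen n q i = hecke_class n q (free_gen i)"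

definition perm_of_word :: "nat list \<Rightarrow> nat \<Rightarrow> nat"
  where "perm_of_word is = foldr (\<lambda>i p. transpose i (i + 1) \<circ> p) is id"

definition expression :: "nat \<Rightarrow> (nat \<Rightarrow> nat) \<Rightarrow> nat list \<Rightarrow> bool"
  where "expression n w is \<longleftrightarrow> set is \<subseteq> {1..<n} \<and> perm_of_word is = w"

definition reduced_expression :: "nat \<Rightarrow> (nat \<Rightarrow> nat) \<Rightarrow> nat list \<Rightarrow> bool"
  where "reduced_expression n w is \<longleftrightarrow>
    expression n w is \<and> (\<forall>js. expression n w js \<longrightarrow> length is \<le> length js)"

definition hecke_word :: "nat \<Rightarrow> real \<Rightarrow> nat list \<Rightarrow> free_elem set"
  where "hecke_word n q is =
    foldr (\<lambda>i h. hecke_gen n q i \<otimes>\<^bsub>hecke n q\<^esub> h) is \<one>\<^bsub>hecke n q\<^esub>"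

text \<open>By Matsumoto's theorem the value does not depend on the reduced expression chosen.\<close>

definition hecke_T :: "nat \<Rightarrow> real \<Rightarrow> (nat \<Rightarrow> nat) \<Rightarrow> free_elem set"
  where "hecke_T n q w = hecke_word n q (SOME is. reduced_expression n w is)"

definition jucys_murphy :: "nat \<Rightarrow> real \<Rightarrow> nat \<Rightarrow> free_elem set"
  where "jucys_murphy n q m =
    (\<Oplus>\<^bsub>hecke n q\<^esub>i\<in>{1..m - 1}.
      hecke_smult n q (of_real (q powi (int i - int m))) (hecke_T n q (transpose i m)))"


subsection \<open>Partitions and tableaux\<close>

definition partitions_of :: "nat \<Rightarrow> nat list set"
  where "partitions_of n = {lam. sorted_wrt (\<ge>) lam \<and> 0 \<notin> set lam \<and> sum_list lam = n}"

text \<open>Boxes are (row, column) pairs, with rows and columns numbered from 1.\<close>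

definition diagram :: "nat list \<Rightarrow> (nat \<times> nat) set"
  where "diagram lam =
    {(i, j). 1 \<le> i \<and> i \<le> length lam \<and> 1 \<le> j \<and> j \<le> lam ! (i - 1)}"

text \<open>A filling of a set of boxes is extended by 0 to all pairs. Since the entries of a
  standard filling are positive, it determines its set of boxes.\<close>

definition standard_fillings :: "(nat \<times> nat) set \<Rightarrow> (nat \<times> nat \<Rightarrow> nat) set"
  where "standard_fillings D = {S.
    bij_betw S D {1..card D} \<and> (\<forall>b. b \<notin> D \<longrightarrow> S b = 0) \<and>
    (\<forall>i j j'. (i, j) \<in> D \<and> (i, j') \<in> D \<and> j < j' \<longrightarrow> S (i, j) < S (i, j')) \<and>
    (\<forall>i i' j. (i, j) \<in> D \<and> (i', j) \<in> D \<and> i < i' \<longrightarrow> S (i, j) < S (i', j))}"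

definition SYT :: "nat list \<Rightarrow> (nat \<times> nat \<Rightarrow> nat) set"
  where "SYT lam = standard_fillings (diagram lam)"

definition num_SYT :: "nat list \<Rightarrow> nat"
  where "num_SYT lam = card (SYT lam)"

definition num_skew_SYT :: "nat list \<Rightarrow> nat list \<Rightarrow> nat"
  where "num_skew_SYT lam mu = card (standard_fillings (diagram lam - diagram mu))"

definition box_of :: "(nat \<times> nat \<Rightarrow> nat) \<Rightarrow> nat \<Rightarrow> nat \<times> nat"
  where "box_of S m = (THE b. S b = m)"

definition content :: "(nat \<times> nat \<Rightarrow> nat) \<Rightarrow> nat \<Rightarrow> int"
  where "content S m = int (snd (box_of S m)) - int (fst (box_of S m))"

definition assigned :: "nat \<Rightarrow> (nat \<times> nat \<Rightarrow> nat) \<Rightarrow> nat list \<Rightarrow> bool"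
  where "assigned m S mu \<longleftrightarrow> diagram mu = {b. S b \<in> {1..m}}"

definition Diag :: "real \<Rightarrow> nat list \<Rightarrow> real"
  where "Diag q nu = (\<Sum>(i, j)\<in>diagram nu. qint q (int j - int i))"


subsection \<open>Modules\<close>

locale hecke_module = vector_space scale
  for scale :: "complex \<Rightarrow> 'v::ab_group_add \<Rightarrow> 'v" +
  fixes n :: nat and q :: real
    and act :: "free_elem set \<Rightarrow> 'v \<Rightarrow> 'v"
  assumes act_linear: "h \<in> carrier (hecke n q) \<Longrightarrow> Vector_Spaces.linear scale scale (act h)"
    and act_one: "act \<one>\<^bsub>hecke n q\<^esub> x = x"
    and act_mult: "\<lbrakk>g \<in> carrier (hecke n q); h \<in> carrier (hecke n q)\<rbrakk>
      \<Longrightarrow> act (g \<otimes>\<^bsub>hecke n q\<^esub> h) x = act g (act h x)"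
    and act_add: "\<lbrakk>g \<in> carrier (hecke n q); h \<in> carrier (hecke n q)\<rbrakk>
      \<Longrightarrow> act (g \<oplus>\<^bsub>hecke n q\<^esub> h) x = act g x + act h x"
    and act_smult: "h \<in> carrier (hecke n q)
      \<Longrightarrow> act (hecke_smult n q c h) x = scale c (act h x)"

locale irreducible_hecke_module = hecke_module scale n q act
  for scale :: "complex \<Rightarrow> 'v::ab_group_add \<Rightarrow> 'v" and n q act +
  assumes nontrivial: "\<exists>x::'v. x \<noteq> 0"
    and irreducible: "\<lbrakk>subspace W; \<And>h x. \<lbrakk>h \<in> carrier (hecke n q); x \<in> W\<rbrakk> \<Longrightarrow> act h x \<in> W\<rbrakk>
      \<Longrightarrow> W = {0} \<or> W = UNIV"

text \<open>The irreducible module indexed by \<open>lam\<close>, together with a seminormal basis.\<close>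

locale seminormal_module = irreducible_hecke_module scale n q act
  for scale :: "complex \<Rightarrow> 'v::ab_group_add \<Rightarrow> 'v" and n q act +
  fixes lam :: "nat list" and v :: "(nat \<times> nat \<Rightarrow> nat) \<Rightarrow> 'v"
  assumes shape: "lam \<in> partitions_of n"
    and basis_inj: "inj_on v (SYT lam)"
    and basis_independent: "independent (v ` SYT lam)"
    and basis_span: "span (v ` SYT lam) = UNIV"
    and jucys_murphy_eigen: "\<lbrakk>S \<in> SYT lam; m \<in> {2..n}\<rbrakk>
      \<Longrightarrow> act (jucys_murphy n q m) (v S) = scale (of_real (qint q (content S m))) (v S)"

definition eigenvalue_at ::
    "(complex \<Rightarrow> 'v::ab_group_add \<Rightarrow> 'v) \<Rightarrow> ('v \<Rightarrow> 'v) \<Rightarrow> 'v \<Rightarrow> complex \<Rightarrow> bool"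
  where "eigenvalue_at scale f x c \<longleftrightarrow> x \<noteq> 0 \<and> f x = scale c x"


subsection \<open>The element \<open>P\<close> and its eigenvalues\<close>

definition coeff_P :: "nat \<Rightarrow> nat \<Rightarrow> real \<Rightarrow> real"
  where "coeff_P n k q =
    q * qint q (int n - 1) / (qint q (int n) * (\<Sum>l=1..k. qint q (int n - int l)))"

definition hecke_P :: "nat \<Rightarrow> nat \<Rightarrow> real \<Rightarrow> free_elem set"
  where "hecke_P n k q =
    hecke_smult n q (of_real (1 / qint q (int n))) \<one>\<^bsub>hecke n q\<^esub>
    \<oplus>\<^bsub>hecke n q\<^esub>
    hecke_smult n q (of_real (coeff_P n k q))
      (\<Oplus>\<^bsub>hecke n q\<^esub>l\<in>{1..k}. jucys_murphy n q (n + 1 - l))"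

definition eig_tableau :: "nat \<Rightarrow> nat \<Rightarrow> real \<Rightarrow> (nat \<times> nat \<Rightarrow> nat) \<Rightarrow> real"
  where "eig_tableau n k q S =
    1 / qint q (int n) + coeff_P n k q * (\<Sum>l=1..k. qint q (content S (n + 1 - l)))"

definition eig_pair :: "nat \<Rightarrow> nat \<Rightarrow> real \<Rightarrow> nat list \<Rightarrow> nat list \<Rightarrow> real"
  where "eig_pair n k q lam mu =
    1 / qint q (int n) + coeff_P n k q * (Diag q lam - Diag q mu)"

text \<open>The number of basis vectors \<open>v S\<close> whose tableau is assigned \<open>(lam, mu)\<close>.\<close>

definition pair_multiplicity ::
    "nat \<Rightarrow> nat \<Rightarrow> ((nat \<times> nat \<Rightarrow> nat) \<Rightarrow> 'v) \<Rightarrow> nat list \<Rightarrow> nat list \<Rightarrow> nat"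
  where "pair_multiplicity n k v lam mu = card {v S | S. S \<in> SYT lam \<and> assigned (n - k) S mu}"

end

theory Submission
  imports Defs
begin

text \<open>
  On a seminormal basis vector each Jucys--Murphy element acts by the \<open>q\<close>-content of one entry of
  the tableau, so \<open>P\<close> acts on \<open>v S\<close> by an affine function of the sum of the \<open>q\<close>-contents of the
  entries \<open>n - k + 1, \<dots>, n\<close>. That sum sees only where these entries lie, not how they are arranged:
  they fill the boxes of the shape outside the boxes \<open>mu\<close> of the entries \<open>1, \<dots>, n - k\<close>, and
  the sum is the difference of the two diagonal sums (\<open>sum_contents_eq_Diag_diff\<close>).

  Two facts about tableaux turn this into an indexing by pairs. Rows and columns increase, so the
  boxes of the entries up to a bound form an order ideal of the diagram, and an order ideal of a
  diagram is the diagram of exactly one partition (\<open>order_ideal_is_diagram\<close>, \<open>diagram_inject\<close>).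
  Conversely, cutting a tableau between \<open>n - k\<close> and \<open>n - k + 1\<close> is a bijection onto
  pairs of a tableau of shape \<open>mu\<close> and a standard filling of the skew shape
  (\<open>bij_betw_glue_fillings\<close>), which counts the multiplicity. Every pair does occur, because every
  finite set of boxes has a standard filling (\<open>standard_fillings_nonempty\<close>).

  On the algebraic side the Hecke algebra is a quotient of a free algebra by generators and
  relations, and the module axioms apply only to elements of its carrier. Membership of \<open>P\<close>
  in the carrier rests on every transposition having a reduced expression, since \<open>hecke_T\<close> picks one by
  Hilbert choice.
\<close>

section \<open>Standard fillings\<close>

text \<open>Only boxes in a common row or column are compared, as in the definition of a standard
  filling; for a set of boxes with gaps this is weaker than being closed in the
  componentwise order.\<close>

definition order_ideal :: "(nat \<times> nat) set \<Rightarrow> (nat \<times> nat) set \<Rightarrow> bool"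
  where "order_ideal D E \<longleftrightarrow> E \<subseteq> D \<and>
    (\<forall>i j j'. (i, j) \<in> D \<and> (i, j') \<in> E \<and> j < j' \<longrightarrow> (i, j) \<in> E) \<and>
    (\<forall>i i' j. (i, j) \<in> D \<and> (i', j) \<in> E \<and> i < i' \<longrightarrow> (i, j) \<in> E)"

text \<open>An injection from a finite set into one of the same size is a bijection, so a
  filling is built by giving an injection with entries in the right range.\<close>

lemma standard_fillings_iff:
  assumes "finite D"
  shows "S \<in> standard_fillings D \<longleftrightarrow>
    inj_on S D \<and> S ` D \<subseteq> {1..card D} \<and> (\<forall>b. b \<notin> D \<longrightarrow> S b = 0) \<and>
    (\<forall>i j j'. (i, j) \<in> D \<and> (i, j') \<in> D \<and> j < j' \<longrightarrow> S (i, j) < S (i, j')) \<and>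
    (\<forall>i i' j. (i, j) \<in> D \<and> (i', j) \<in> D \<and> i < i' \<longrightarrow> S (i, j) < S (i', j))"
proof -
  have "bij_betw S D {1..card D} \<longleftrightarrow> inj_on S D \<and> S ` D \<subseteq> {1..card D}"
    unfolding bij_betw_def using card_subset_eq[of "{1..card D}" "S ` D"] by (auto simp: card_image)
  then show ?thesis unfolding standard_fillings_def by auto
qed

lemma standard_fillings_bij:
  "S \<in> standard_fillings D \<Longrightarrow> bij_betw S D {1..card D}"
  unfolding standard_fillings_def by (drule CollectD) (elim conjE)

lemma standard_filling_support:
  assumes "S \<in> standard_fillings D"
  shows "S b = 0 \<longleftrightarrow> b \<notin> D"
proof
  assume "S b = 0"
  then show "b \<notin> D" using bij_betw_apply[OF standard_fillings_bij[OF assms], of b] by auto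
next
  assume "b \<notin> D"
  then show "S b = 0" using assms unfolding standard_fillings_def by blast
qed

text \<open>A box maximising the sum of its coordinates has no box of the set to its right
  or below it, so it can take the largest entry on top of a filling of the remaining boxes.\<close>

lemma standard_fillings_nonempty:
  assumes "finite D"
  shows "standard_fillings D \<noteq> {}"
  using assms
proof (induction "card D" arbitrary: D)
  case 0
  then have "(\<lambda>_. 0) \<in> standard_fillings D" by (simp add: standard_fillings_iff)
  then show ?case by blast
next
  case (Suc c)
  then have "D \<noteq> {}" by auto
  have "\<exists>b\<in>D. \<forall>b'\<in>D. fst b' + snd b' \<le> fst b + snd b"
  proof -
    let ?M = "Max ((\<lambda>b. fst b + snd b) ` D)"
    have "?M \<in> (\<lambda>b. fst b + snd b) ` D" using \<open>D \<noteq> {}\<close> Suc.prems by simp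
    then obtain b where "b \<in> D" "?M = fst b + snd b" by blast
    then show ?thesis using Suc.prems
      by (metis (no_types, lifting) Max_ge finite_imageI image_eqI)
  qed
  then obtain b where b: "b \<in> D" and max: "\<forall>b'\<in>D. fst b' + snd b' \<le> fst b + snd b" by blast
  have card: "card (D - {b}) = c" using b Suc.hyps(2) Suc.prems by simp
  then obtain S where "S \<in> standard_fillings (D - {b})"
    using Suc.hyps(1)[of "D - {b}"] Suc.prems by auto
  then have S: "inj_on S (D - {b})" "\<And>x. x \<in> D \<Longrightarrow> x \<noteq> b \<Longrightarrow> 1 \<le> S x \<and> S x \<le> c"
     "\<And>x. x \<notin> D - {b} \<Longrightarrow> S x = 0"
     "\<And>i j j'. (i, j) \<in> D - {b} \<Longrightarrow> (i, j') \<in> D - {b} \<Longrightarrow> j < j' \<Longrightarrow> S (i, j) < S (i, j')"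
     "\<And>i i' j. (i, j) \<in> D - {b} \<Longrightarrow> (i', j) \<in> D - {b} \<Longrightarrow> i < i' \<Longrightarrow> S (i, j) < S (i', j)"
    using Suc.prems card by (auto simp: standard_fillings_iff)
  have "S(b := Suc c) \<in> standard_fillings D"
    unfolding standard_fillings_iff[OF Suc.prems] Suc.hyps(2)[symmetric]
  proof (intro conjI allI impI)
    show "inj_on (S(b := Suc c)) D"
      using S(1) S(2) unfolding inj_on_def by (metis DiffI fun_upd_apply not_less_eq_eq order_refl singletonD)
    show "S(b := Suc c) ` D \<subseteq> {1..Suc c}" using S(2) by (force simp: fun_upd_def)
    show "(S(b := Suc c)) x = 0" if "x \<notin> D" for x using that b S(3) by auto
    show "(S(b := Suc c)) (i, j) < (S(b := Suc c)) (i, j')"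
      if "(i, j) \<in> D \<and> (i, j') \<in> D \<and> j < j'" for i j j'
    proof -
      have "(i, j) \<noteq> b" using max that by force
      then show ?thesis using that S(2)[of "(i,j)"] S(4)[of i j j'] by auto
    qed
    show "(S(b := Suc c)) (i, j) < (S(b := Suc c)) (i', j)"
      if "(i, j) \<in> D \<and> (i', j) \<in> D \<and> i < i'" for i i' j
    proof -
      have "(i, j) \<noteq> b" using max that by force
      then show ?thesis using that S(2)[of "(i,j)"] S(5)[of i j i'] by auto
    qed
  qed
  then show ?case by blast
qed

lemma order_ideal_initial_boxes:
  assumes "S \<in> standard_fillings D"
  shows "order_ideal D {b. S b \<in> {1..m}}"
proof -
  have pos: "1 \<le> S b \<longleftrightarrow> b \<in> D" for b
    using standard_filling_support[OF assms, of b] by auto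
  have row: "S (i, j) < S (i, j')" if "(i, j) \<in> D" "(i, j') \<in> D" "j < j'" for i j j'
    using assms that unfolding standard_fillings_def by blast
  have col: "S (i, j) < S (i', j)" if "(i, j) \<in> D" "(i', j) \<in> D" "i < i'" for i i' j
    using assms that unfolding standard_fillings_def by blast
  show ?thesis
    unfolding order_ideal_def
  proof (intro conjI allI impI)
    show "{b. S b \<in> {1..m}} \<subseteq> D" using pos by auto
    show "(i, j) \<in> {b. S b \<in> {1..m}}"
      if "(i, j) \<in> D \<and> (i, j') \<in> {b. S b \<in> {1..m}} \<and> j < j'" for i j j'
      using that pos[of "(i, j)"] pos[of "(i, j')"] row[of i j j'] by auto
    show "(i, j) \<in> {b. S b \<in> {1..m}}"
      if "(i, j) \<in> D \<and> (i', j) \<in> {b. S b \<in> {1..m}} \<and> i < i'" for i i' j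
      using that pos[of "(i, j)"] pos[of "(i', j)"] col[of i j i'] by auto
  qed
qed

lemma bij_betw_vimage_restrict:
  assumes "bij_betw f A B" and "C \<subseteq> B"
  shows "bij_betw f {a \<in> A. f a \<in> C} C"
proof (rule bij_betw_subset[OF assms(1)])
  have "f ` A = B" using assms(1) by (rule bij_betw_imp_surj_on)
  then show "f ` {a \<in> A. f a \<in> C} = C" using assms(2) by blast
qed blast

lemma card_initial_boxes:
  assumes "S \<in> standard_fillings D" and "m \<le> card D"
  shows "card {b. S b \<in> {1..m}} = m"
proof -
  have "{b. S b \<in> {1..m}} = {b \<in> D. S b \<in> {1..m}}"
  proof (rule Collect_cong)
    show "S b \<in> {1..m} \<longleftrightarrow> b \<in> D \<and> S b \<in> {1..m}" for b
      using standard_filling_support[OF assms(1), of b] by auto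
  qed
  moreover have "bij_betw S {b \<in> D. S b \<in> {1..m}} {1..m}"
    using assms(2) by (intro bij_betw_vimage_restrict[OF standard_fillings_bij[OF assms(1)]]) auto
  ultimately show ?thesis using bij_betw_same_card by fastforce
qed

text \<open>A standard filling whose smallest entries occupy \<open>E\<close> is a standard filling of \<open>E\<close> together
  with one of the complement, its entries shifted up by \<open>card E\<close>. Gluing preserves the
  order across the two parts since \<open>E\<close> is an order ideal: a box of \<open>E\<close> never lies to the right of
  or below a box of the complement in the same row or column.\<close>

lemma bij_betw_glue_fillings:
  assumes fin: "finite D" and E: "order_ideal D E"
  shows "bij_betw (\<lambda>(A, B) b. if b \<in> E then A b else if b \<in> D then B b + card E else 0)
    (standard_fillings E \<times> standard_fillings (D - E))
    {S \<in> standard_fillings D. E = {b. S b \<in> {1..card E}}}"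
    (is "bij_betw ?glue ?pairs ?fillings")
proof -
  have ED: "E \<subseteq> D" and
    row: "\<And>i j j'. (i, j) \<in> D \<Longrightarrow> (i, j') \<in> E \<Longrightarrow> j < j' \<Longrightarrow> (i, j) \<in> E" and
    col: "\<And>i i' j. (i, j) \<in> D \<Longrightarrow> (i', j) \<in> E \<Longrightarrow> i < i' \<Longrightarrow> (i, j) \<in> E"
    using E unfolding order_ideal_def by metis+
  have finE: "finite E" "finite (D - E)" using fin ED finite_subset by auto
  have card: "card D = card E + card (D - E)"
    using ED fin by (metis card_Diff_subset card_mono finE(1) le_add_diff_inverse)
  let ?split = "\<lambda>S. (\<lambda>b. if b \<in> E then S b else 0, \<lambda>b. if b \<in> D - E then S b - card E else 0)"
  show ?thesis
  proof (rule bij_betw_byWitness[where f' = ?split])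
    show "\<forall>p\<in>?pairs. ?split (?glue p) = p"
      using ED by (auto simp: fun_eq_iff standard_fillings_def)
    show "\<forall>S\<in>?fillings. ?glue (?split S) = S"
    proof
      fix S assume S: "S \<in> ?fillings"
      have "S b - card E + card E = S b" if "b \<notin> E" "b \<in> D" for b
        using that S standard_filling_support[of S D b] by fastforce
      then show "?glue (?split S) = S"
        using S standard_filling_support[of S D] by (auto simp: fun_eq_iff)
    qed
    show "?glue ` ?pairs \<subseteq> ?fillings"
    proof (intro image_subsetI)
      fix p assume "p \<in> ?pairs"
      then obtain A B where p: "p = (A, B)"
        and A: "A \<in> standard_fillings E" and B: "B \<in> standard_fillings (D - E)" by blast
      note A' = A[unfolded standard_fillings_iff[OF finE(1)]]
      note B' = B[unfolded standard_fillings_iff[OF finE(2)]]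
      have bA: "b \<in> E \<Longrightarrow> 1 \<le> A b \<and> A b \<le> card E" for b using A' by auto
      have bB: "b \<in> D \<Longrightarrow> b \<notin> E \<Longrightarrow> 1 \<le> B b \<and> B b \<le> card (D - E)" for b using B' by auto
      let ?S = "\<lambda>b. if b \<in> E then A b else if b \<in> D then B b + card E else 0"
      have "?S \<in> standard_fillings D"
        unfolding standard_fillings_iff[OF fin]
      proof (intro conjI allI impI)
        show "inj_on ?S D"
        proof (rule inj_onI)
          fix x y assume xy: "x \<in> D" "y \<in> D" "?S x = ?S y"
          have "x \<in> E \<longleftrightarrow> y \<in> E"
            using xy bA[of x] bA[of y] bB[of x] bB[of y] by (auto split: if_splits)
          then show "x = y"
            using xy A' B' by (auto split: if_splits dest: inj_onD)
        qed
        show "?S ` D \<subseteq> {1..card D}" using bA bB by (force simp: card)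
        show "?S b = 0" if "b \<notin> D" for b using that ED by auto
        show "?S (i, j) < ?S (i, j')" if "(i, j) \<in> D \<and> (i, j') \<in> D \<and> j < j'" for i j j'
          using that A' B' row[of i j j'] bA[of "(i,j)"] bB[of "(i,j')"] by auto
        show "?S (i, j) < ?S (i', j)" if "(i, j) \<in> D \<and> (i', j) \<in> D \<and> i < i'" for i i' j
          using that A' B' col[of i j i'] bA[of "(i,j)"] bB[of "(i',j)"] by auto
      qed
      moreover have "b \<in> E \<longleftrightarrow> ?S b \<in> {1..card E}" for b
        using bA[of b] bB[of b] by auto
      ultimately show "?glue p \<in> ?fillings" by (simp add: p)
    qed
    show "?split ` ?fillings \<subseteq> ?pairs"
    proof (intro image_subsetI)
      fix S assume S: "S \<in> ?fillings"
      then have S': "inj_on S D" "\<And>b. b \<in> D \<Longrightarrow> S b \<le> card D"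
        "\<And>i j j'. (i, j) \<in> D \<Longrightarrow> (i, j') \<in> D \<Longrightarrow> j < j' \<Longrightarrow> S (i, j) < S (i, j')"
        "\<And>i i' j. (i, j) \<in> D \<Longrightarrow> (i', j) \<in> D \<Longrightarrow> i < i' \<Longrightarrow> S (i, j) < S (i', j)"
        by (auto simp: standard_fillings_iff[OF fin])
      have inE: "1 \<le> S b \<and> S b \<le> card E" if "b \<in> E" for b using S that by auto
      have notinE: "card E < S b" if "b \<in> D" "b \<notin> E" for b
        using S that standard_filling_support[of S D b] by fastforce
      have "fst (?split S) \<in> standard_fillings E"
        unfolding standard_fillings_iff[OF finE(1)]
      proof (intro conjI allI impI)
        have "inj_on S E" using S'(1) ED by (rule inj_on_subset)
        then show "inj_on (fst (?split S)) E" by (simp add: inj_on_def)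
        show "fst (?split S) ` E \<subseteq> {1..card E}" using inE by auto
        show "fst (?split S) b = 0" if "b \<notin> E" for b using that by simp
        show "fst (?split S) (i, j) < fst (?split S) (i, j')"
          if "(i, j) \<in> E \<and> (i, j') \<in> E \<and> j < j'" for i j j'
          using that ED S'(3)[of i j j'] by auto
        show "fst (?split S) (i, j) < fst (?split S) (i', j)"
          if "(i, j) \<in> E \<and> (i', j) \<in> E \<and> i < i'" for i i' j
          using that ED S'(4)[of i j i'] by auto
      qed
      moreover have "snd (?split S) \<in> standard_fillings (D - E)"
        unfolding standard_fillings_iff[OF finE(2)]
      proof (intro conjI allI impI)
        show "inj_on (snd (?split S)) (D - E)"
        proof (rule inj_onI)
          fix x y assume xy: "x \<in> D - E" "y \<in> D - E" "snd (?split S) x = snd (?split S) y"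
          then have "S x = S y" using notinE[of x] notinE[of y] by auto
          then show "x = y" using xy S'(1) by (auto dest: inj_onD)
        qed
        show "snd (?split S) ` (D - E) \<subseteq> {1..card (D - E)}"
        proof (intro image_subsetI)
          fix x assume "x \<in> D - E"
          then show "snd (?split S) x \<in> {1..card (D - E)}"
            using notinE[of x] S'(2)[of x] card by auto
        qed
        show "snd (?split S) b = 0" if "b \<notin> D - E" for b using that by auto
        show "snd (?split S) (i, j) < snd (?split S) (i, j')"
          if "(i, j) \<in> D - E \<and> (i, j') \<in> D - E \<and> j < j'" for i j j'
          using that notinE[of "(i,j)"] notinE[of "(i,j')"] S'(3)[of i j j'] by auto
        show "snd (?split S) (i, j) < snd (?split S) (i', j)"
          if "(i, j) \<in> D - E \<and> (i', j) \<in> D - E \<and> i < i'" for i i' j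
          using that notinE[of "(i,j)"] notinE[of "(i',j)"] S'(4)[of i j i'] by auto
      qed
      ultimately show "?split S \<in> ?pairs" by (simp add: mem_Times_iff)
    qed
  qed
qed


section \<open>Diagrams of partitions\<close>

lemma diagram_Sigma: "diagram lam = (SIGMA i:{1..length lam}. {1..lam ! (i - 1)})"
  unfolding diagram_def by auto

lemma finite_diagram: "finite (diagram lam)"
  unfolding diagram_Sigma by simp

lemma card_diagram: "card (diagram lam) = sum_list lam"
proof -
  have "card (diagram lam) = (\<Sum>i=1..length lam. lam ! (i - 1))"
    unfolding diagram_Sigma by simp
  also have "\<dots> = (\<Sum>i<length lam. lam ! i)"
    by (rule sum.reindex_bij_witness[where i = Suc and j = "\<lambda>i. i - 1"]) auto
  finally show ?thesis by (simp add: sum_list_sum_nth atLeast0LessThan)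
qed

text \<open>All parts are positive, so the first column shows the number of parts.\<close>

lemma diagram_inject:
  assumes "lam \<in> partitions_of m" "mu \<in> partitions_of m'" and eq: "diagram lam = diagram mu"
  shows "lam = mu"
proof (rule nth_equalityI)
  have length: "{1..length nu} = {i. (i, 1) \<in> diagram nu}" if "nu \<in> partitions_of k" for nu k
  proof -
    have "1 \<le> nu ! (i - 1)" if "1 \<le> i" "i \<le> length nu" for i
    proof -
      have "nu ! (i - 1) \<in> set nu" using that by (intro nth_mem) auto
      moreover have "0 \<notin> set nu" using \<open>nu \<in> partitions_of k\<close> by (simp add: partitions_of_def)
      ultimately show ?thesis by (metis One_nat_def Suc_leI gr0I)
    qed
    then show ?thesis by (auto simp: diagram_def)
  qed
  have "{1..length lam} = {1..length mu}"
    using length[OF assms(1)] length[OF assms(2)] eq by simp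
  then show len: "length lam = length mu" by (metis card_atLeastAtMost diff_Suc_1)
  fix i assume "i < length lam"
  then have "{1..lam ! i} = {j. (Suc i, j) \<in> diagram lam}"
      "{1..mu ! i} = {j. (Suc i, j) \<in> diagram mu}"
    using len by (auto simp: diagram_def)
  then have "{1..lam ! i} = {1..mu ! i}" using eq by simp
  then show "lam ! i = mu ! i" by (metis card_atLeastAtMost diff_Suc_1)
qed

lemma diagram_mono_closed:
  assumes "lam \<in> partitions_of m" and "(i, j) \<in> diagram lam"
    and "1 \<le> i'" "i' \<le> i" "1 \<le> j'" "j' \<le> j"
  shows "(i', j') \<in> diagram lam"
proof -
  have "lam ! (i - 1) \<le> lam ! (i' - 1)"
  proof (cases "i' = i")
    case False
    then show ?thesis
      using assms unfolding partitions_of_def diagram_def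
      by (auto simp: sorted_wrt_iff_nth_less)
  qed simp
  then show ?thesis using assms by (auto simp: diagram_def)
qed

lemma order_ideal_diagram:
  assumes "mu \<in> partitions_of m" and "diagram mu \<subseteq> diagram lam"
  shows "order_ideal (diagram lam) (diagram mu)"
  unfolding order_ideal_def
proof (intro conjI allI impI)
  have pos: "1 \<le> i \<and> 1 \<le> j" if "(i, j) \<in> diagram lam" for i j
    using that by (simp add: diagram_def)
  show "(i, j) \<in> diagram mu"
    if "(i, j) \<in> diagram lam \<and> (i, j') \<in> diagram mu \<and> j < j'" for i j j'
    using that pos[of i j] diagram_mono_closed[OF assms(1), of i j' i j] by auto
  show "(i, j) \<in> diagram mu"
    if "(i, j) \<in> diagram lam \<and> (i', j) \<in> diagram mu \<and> i < i'" for i i' j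
    using that pos[of i j] diagram_mono_closed[OF assms(1), of i' j i j] by auto
qed fact

text \<open>Applied to the rows and to the first column of an order ideal of a diagram, this
  shows that they have no gaps.\<close>

lemma down_closed_nat_set:
  fixes A :: "nat set"
  assumes "finite A" "0 \<notin> A" and "\<And>x y. y \<in> A \<Longrightarrow> 1 \<le> x \<Longrightarrow> x < y \<Longrightarrow> x \<in> A"
  shows "A = {1..card A}"
proof (cases "A = {}")
  case False
  then have max: "Max A \<in> A" using assms(1) by simp
  have "A = {1..Max A}"
  proof (intro equalityI subsetI)
    fix x assume "x \<in> A"
    then show "x \<in> {1..Max A}" using assms(1,2) by (cases x) auto
  next
    fix x assume "x \<in> {1..Max A}"
    then show "x \<in> A" using assms(3)[OF max, of x] max by (cases "x = Max A") auto
  qed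
  then show ?thesis by (metis card_atLeastAtMost diff_Suc_1)
qed simp

text \<open>The parts of the partition are the row lengths. There are as many of them as boxes in the first
  column, since every row of the ideal reaches it.\<close>

lemma order_ideal_is_diagram:
  assumes lam: "lam \<in> partitions_of n" and E: "order_ideal (diagram lam) E"
  shows "\<exists>mu. mu \<in> partitions_of (card E) \<and> diagram mu = E"
proof -
  have sub: "E \<subseteq> diagram lam" using E by (simp add: order_ideal_def)
  then have fin: "finite E" using finite_diagram finite_subset by blast
  have pos: "1 \<le> i \<and> 1 \<le> j" if "(i, j) \<in> E" for i j
    using that sub by (auto simp: diagram_def)
  \<comment> \<open>Inside a diagram a componentwise step is a step within column \<open>j\<close> followed by one within
    row \<open>i'\<close>, with the corner \<open>(i', j)\<close> again in the diagram.\<close>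
  have down: "(i', j') \<in> E" if "(i, j) \<in> E" "1 \<le> i'" "i' \<le> i" "1 \<le> j'" "j' \<le> j" for i i' j j'
  proof -
    have "(i', j') \<in> diagram lam" "(i', j) \<in> diagram lam"
      using that pos[of i j] sub
        diagram_mono_closed[OF lam, of i j i' j'] diagram_mono_closed[OF lam, of i j i' j] by auto
    then show ?thesis using E that unfolding order_ideal_def
      by (metis le_neq_implies_less)
  qed
  define row where "row i = card {j. (i, j) \<in> E}" for i
  define r where "r = card {i. (i, 1) \<in> E}"
  have finr: "finite {j. (i, j) \<in> E}" for i
    by (rule finite_subset[OF _ finite_imageI[OF fin, of snd]]) force
  have finc: "finite {i. (i, j) \<in> E}" for j
    by (rule finite_subset[OF _ finite_imageI[OF fin, of fst]]) force
  have row: "{j. (i, j) \<in> E} = {1..row i}" for i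
    unfolding row_def
  proof (rule down_closed_nat_set[OF finr])
    show "0 \<notin> {j. (i, j) \<in> E}" using pos[of i 0] by auto
    show "x \<in> {j. (i, j) \<in> E}" if "y \<in> {j. (i, j) \<in> E}" "1 \<le> x" "x < y" for x y
      using that down[of i y i x] pos[of i y] by auto
  qed
  have col: "{i. (i, 1) \<in> E} = {1..r}"
    unfolding r_def
  proof (rule down_closed_nat_set[OF finc])
    show "0 \<notin> {i. (i, 1) \<in> E}" using pos[of 0 1] by auto
    show "x \<in> {i. (i, 1) \<in> E}" if "y \<in> {i. (i, 1) \<in> E}" "1 \<le> x" "x < y" for x y
      using that down[of y 1 x 1] by auto
  qed
  have row_iff: "(i, j) \<in> E \<longleftrightarrow> 1 \<le> j \<and> j \<le> row i" for i j
    using row[of i] unfolding set_eq_iff mem_Collect_eq atLeastAtMost_iff by (rule spec)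
  have col_iff: "(i, 1) \<in> E \<longleftrightarrow> 1 \<le> i \<and> i \<le> r" for i
    using col unfolding set_eq_iff mem_Collect_eq atLeastAtMost_iff by (rule spec)
  define mu where "mu = map row [1..<Suc r]"
  have nth: "mu ! (i - 1) = row i" if "1 \<le> i" "i \<le> r" for i
    using that unfolding mu_def by (simp del: upt_Suc)
  have diag: "diagram mu = E"
  proof -
    have "(i, j) \<in> diagram mu \<longleftrightarrow> (i, j) \<in> E" for i j
    proof -
      have "1 \<le> i \<and> i \<le> r" if "(i, j) \<in> E"
        using down[OF that, of i 1] pos[OF that] col_iff[of i] by simp
      then show ?thesis
        using nth[of i] row_iff[of i j] by (auto simp: diagram_def mu_def simp del: upt_Suc)
    qed
    then show ?thesis by auto
  qed
  have mono: "row i' \<le> row i" if "1 \<le> i" "i \<le> i'" for i i'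
  proof -
    have "{1..row i'} \<subseteq> {1..row i}"
      unfolding row[symmetric] using that down[of i' _ i] pos[of i'] by auto
    then show ?thesis by (cases "row i' = 0") auto
  qed
  have "sorted_wrt (\<ge>) mu"
    unfolding mu_def sorted_wrt_iff_nth_less by (auto intro!: mono simp del: upt_Suc)
  moreover have "0 \<notin> set mu"
  proof
    assume "0 \<in> set mu"
    then have "0 \<in> row ` {1..r}" unfolding mu_def by (auto simp del: upt_Suc)
    then obtain i where i: "i \<in> {1..r}" "row i = 0" by auto
    then have "(i, 1) \<in> E" using col_iff[of i] by simp
    then show False using row_iff[of i 1] i(2) by simp
  qed
  ultimately have "mu \<in> partitions_of (card E)"
    using card_diagram[of mu] diag by (simp add: partitions_of_def)
  then show ?thesis using diag by blast
qed


section \<open>Tableaux and contents\<close>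

text \<open>The tableau restricts to a bijection from \<open>diagram lam - diagram mu\<close> to the entries
  \<open>n - k + 1, \<dots>, n\<close>. Reindexing along it turns contents of entries into contents of boxes.\<close>

lemma sum_contents_eq_Diag_diff:
  assumes S: "S \<in> SYT lam" and lam: "lam \<in> partitions_of n" and "k \<le> n"
    and mu: "assigned (n - k) S mu"
  shows "(\<Sum>l=1..k. qint q (content S (n + 1 - l))) = Diag q lam - Diag q mu"
proof -
  let ?c = "\<lambda>(i, j). qint q (int j - int i)"
  have S': "S \<in> standard_fillings (diagram lam)" using S by (simp add: SYT_def)
  have bij: "bij_betw S (diagram lam) {1..n}"
    using standard_fillings_bij[OF S'] lam by (simp add: card_diagram partitions_of_def)
  have box: "box_of S (S b) = b" if "b \<in> diagram lam" for b
    unfolding box_of_def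
  proof (rule the_equality)
    fix b' assume "S b' = S b"
    moreover from this have "b' \<in> diagram lam"
      using that standard_filling_support[OF S'] by metis
    ultimately show "b' = b" using that bij by (auto simp: bij_betw_def dest: inj_onD)
  qed simp
  have sub: "diagram mu \<subseteq> diagram lam"
    using mu order_ideal_initial_boxes[OF S'] unfolding assigned_def order_ideal_def by metis
  have "diagram lam - diagram mu = {b \<in> diagram lam. S b \<in> {n - k<..n}}"
    using mu bij_betw_apply[OF bij] unfolding assigned_def by auto
  then have "bij_betw S (diagram lam - diagram mu) {n - k<..n}"
    by (simp only:) (rule bij_betw_vimage_restrict[OF bij], auto)
  then have "(\<Sum>b\<in>diagram lam - diagram mu. qint q (content S (S b)))
      = (\<Sum>m\<in>{n - k<..n}. qint q (content S m))"
    by (rule sum.reindex_bij_betw)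
  moreover have "(\<Sum>m\<in>{n - k<..n}. qint q (content S m))
      = (\<Sum>l=1..k. qint q (content S (n + 1 - l)))"
    using \<open>k \<le> n\<close>
    by (intro sum.reindex_bij_witness[where i = "\<lambda>l. n + 1 - l" and j = "\<lambda>m. n + 1 - m"]) auto
  moreover have "(\<Sum>b\<in>diagram lam - diagram mu. qint q (content S (S b)))
      = sum ?c (diagram lam - diagram mu)"
    by (intro sum.cong refl) (auto simp: content_def box)
  moreover have "\<dots> = Diag q lam - Diag q mu"
    unfolding Diag_def by (intro sum_diff finite_diagram sub)
  ultimately show ?thesis by simp
qed

lemma eig_tableau_eq_eig_pair:
  assumes "S \<in> SYT lam" "lam \<in> partitions_of n" "k \<le> n" "assigned (n - k) S mu"
  shows "eig_tableau n k q S = eig_pair n k q lam mu"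
  unfolding eig_tableau_def eig_pair_def sum_contents_eq_Diag_diff[OF assms] ..

lemma ex1_assigned:
  assumes S: "S \<in> SYT lam" and lam: "lam \<in> partitions_of n" and "m \<le> n"
  shows "\<exists>!mu. mu \<in> partitions_of m \<and> diagram mu \<subseteq> diagram lam \<and> assigned m S mu"
proof -
  have S': "S \<in> standard_fillings (diagram lam)" using S by (simp add: SYT_def)
  have "card {b. S b \<in> {1..m}} = m"
    using card_initial_boxes[OF S'] lam \<open>m \<le> n\<close> by (simp add: card_diagram partitions_of_def)
  then obtain mu where mu: "mu \<in> partitions_of m" "diagram mu = {b. S b \<in> {1..m}}"
    using order_ideal_is_diagram[OF lam order_ideal_initial_boxes[OF S']] by metis
  moreover have "diagram mu \<subseteq> diagram lam"
    using order_ideal_initial_boxes[OF S'] mu(2) by (simp add: order_ideal_def)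
  ultimately show ?thesis
    by (intro ex1I[of _ mu]) (auto simp: assigned_def intro: diagram_inject)
qed

lemma bij_betw_tableaux_assigned:
  assumes "mu \<in> partitions_of m" and "diagram mu \<subseteq> diagram lam"
  shows "\<exists>f. bij_betw f (SYT mu \<times> standard_fillings (diagram lam - diagram mu))
    {S \<in> SYT lam. assigned m S mu}"
  using bij_betw_glue_fillings[OF finite_diagram order_ideal_diagram[OF assms]] assms(1)
  by (auto simp: SYT_def assigned_def card_diagram partitions_of_def)

lemma card_tableaux_assigned:
  assumes "mu \<in> partitions_of m" and "diagram mu \<subseteq> diagram lam"
  shows "card {S \<in> SYT lam. assigned m S mu} = num_SYT mu * num_skew_SYT lam mu"
proof -
  have "card (SYT mu \<times> standard_fillings (diagram lam - diagram mu))
      = card {S \<in> SYT lam. assigned m S mu}"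
    using bij_betw_tableaux_assigned[OF assms] bij_betw_same_card by blast
  then show ?thesis by (simp add: card_cartesian_product num_SYT_def num_skew_SYT_def)
qed

lemma ex_tableau_assigned:
  assumes "mu \<in> partitions_of m" and "diagram mu \<subseteq> diagram lam"
  shows "\<exists>S\<in>SYT lam. assigned m S mu"
proof -
  have "SYT mu \<times> standard_fillings (diagram lam - diagram mu) \<noteq> {}"
    using standard_fillings_nonempty finite_diagram by (simp add: SYT_def)
  then show ?thesis
    using bij_betw_tableaux_assigned[OF assms] unfolding bij_betw_def by auto
qed


section \<open>The Hecke algebra\<close>

lemma perm_of_word_append: "perm_of_word (u @ w) = perm_of_word u \<circ> perm_of_word w"
  unfolding perm_of_word_def by (induction u) auto

text \<open>Conjugating \<open>(i m)\<close> by \<open>(m m+1)\<close> gives \<open>(i m+1)\<close>.\<close>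

lemma expression_transpose:
  assumes "1 \<le> i" "i < m" "m \<le> n"
  shows "\<exists>is. expression n (transpose i m) is"
  using assms(2,3)
proof (induction m rule: less_induct)
  case (less m)
  show ?case
  proof (cases "m = Suc i")
    case True
    then have "expression n (transpose i m) [i]"
      using less.prems assms(1) by (simp add: expression_def perm_of_word_def)
    then show ?thesis by blast
  next
    case False
    then obtain m' where m': "m = Suc m'" "i < m'" using less.prems by (cases m) auto
    then obtain w where w: "expression n (transpose i m') w" using less by fastforce
    have "transpose m' (Suc m') \<circ> transpose i m' \<circ> transpose m' (Suc m') = transpose i (Suc m')"
      using m'(2) by (auto simp: fun_eq_iff transpose_def)
    then have "expression n (transpose i m) ([m'] @ w @ [m'])"
      using w m' less.prems assms(1)
      unfolding expression_def perm_of_word_append by (auto simp: perm_of_word_def comp_assoc)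
    then show ?thesis by blast
  qed
qed

lemma expression_imp_reduced_expression:
  assumes "expression n w is"
  shows "\<exists>is. reduced_expression n w is"
  using ex_has_least_nat[of "expression n w", OF assms, of length]
  unfolding reduced_expression_def by blast

lemma free_alg_simps [simp]:
  "mult (free_alg n) = (*)" "one (free_alg n) = 1" "zero (free_alg n) = 0" "add (free_alg n) = (+)"
  by (auto simp: free_alg_def)

lemma free_scalar_in_carrier: "free_scalar c \<in> carrier (free_alg n)"
  by (auto simp: free_alg_def free_scalar_def zero_word_def split: if_splits)

lemma free_gen_in_carrier: "i \<in> {1..<n} \<Longrightarrow> free_gen i \<in> carrier (free_alg n)"
  by (auto simp: free_alg_def free_gen_def split: if_splits)

lemma free_alg_closed:
  assumes "f \<in> carrier (free_alg n)" "g \<in> carrier (free_alg n)"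
  shows "f + g \<in> carrier (free_alg n)" "f - g \<in> carrier (free_alg n)" "f * g \<in> carrier (free_alg n)"
proof -
  show "f + g \<in> carrier (free_alg n)"
    using assms Poly_Mapping.keys_add[of f g] by (force simp: free_alg_def)
  show "f - g \<in> carrier (free_alg n)"
    using assms keys_diff[of f g] by (force simp: free_alg_def)
  show "f * g \<in> carrier (free_alg n)"
    using assms keys_mult[of f g] by (force simp: free_alg_def plus_word_def)
qed

lemma ring_free_alg: "ring (free_alg n)"
proof (rule ringI)
  have zero: "0 \<in> carrier (free_alg n)" by (simp add: free_alg_def)
  have one: "1 \<in> carrier (free_alg n)"
    using free_scalar_in_carrier[of 1] by (simp add: free_scalar_def single_one)
  have "\<exists>y\<in>carrier (free_alg n). y + x = 0" if "x \<in> carrier (free_alg n)" for x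
    using free_alg_closed(2)[OF zero that] by (intro bexI[of _ "- x"]) auto
  then show "abelian_group (free_alg n)"
    by (intro abelian_groupI) (auto simp: free_alg_closed zero algebra_simps)
  show "Group.monoid (free_alg n)"
    by (intro Group.monoidI) (auto simp: free_alg_closed one mult.assoc)
qed (auto simp: algebra_simps)

lemma hecke_relators_in_carrier: "hecke_relators n q \<subseteq> carrier (free_alg n)"
  unfolding hecke_relators_def
  by (auto intro!: free_alg_closed free_scalar_in_carrier free_gen_in_carrier)

lemma ideal_hecke_ideal: "ideal (hecke_ideal n q) (free_alg n)"
  unfolding hecke_ideal_def
  by (rule ring.genideal_ideal[OF ring_free_alg hecke_relators_in_carrier])

lemma ring_hecke: "ring (hecke n q)"
  unfolding hecke_def by (rule ideal.quotient_is_ring[OF ideal_hecke_ideal])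

lemma hecke_class_in_carrier:
  "f \<in> carrier (free_alg n) \<Longrightarrow> hecke_class n q f \<in> carrier (hecke n q)"
  unfolding hecke_def hecke_class_def FactRing_def A_RCOSETS_def' by auto

lemma hecke_smult_in_carrier:
  "h \<in> carrier (hecke n q) \<Longrightarrow> hecke_smult n q c h \<in> carrier (hecke n q)"
  unfolding hecke_smult_def
  by (intro ring.ring_simprules(5)[OF ring_hecke] hecke_class_in_carrier free_scalar_in_carrier)

lemma hecke_word_in_carrier:
  "set is \<subseteq> {1..<n} \<Longrightarrow> hecke_word n q is \<in> carrier (hecke n q)"
  unfolding hecke_word_def hecke_gen_def
  by (induction "is") (auto intro!: ring.ring_simprules(5,6)[OF ring_hecke]
      hecke_class_in_carrier free_gen_in_carrier)

text \<open>Whichever reduced expression \<open>hecke_T\<close> chooses, its letters index generators. Were there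
  none, the choice would be an arbitrary word, whose letters might not index generators.\<close>

lemma hecke_T_transpose_in_carrier:
  assumes "1 \<le> i" "i < m" "m \<le> n"
  shows "hecke_T n q (transpose i m) \<in> carrier (hecke n q)"
proof -
  have "reduced_expression n (transpose i m) (SOME is. reduced_expression n (transpose i m) is)"
    using expression_imp_reduced_expression expression_transpose[OF assms] by (metis someI_ex)
  then have "set (SOME is. reduced_expression n (transpose i m) is) \<subseteq> {1..<n}"
    unfolding reduced_expression_def[of _ _ "Eps _"] expression_def[of _ _ "Eps _"] by (elim conjE)
  then show ?thesis unfolding hecke_T_def by (rule hecke_word_in_carrier)
qed

lemma jucys_murphy_in_carrier:
  assumes "m \<le> n"
  shows "jucys_murphy n q m \<in> carrier (hecke n q)"
proof -
  interpret ring "hecke n q" by (rule ring_hecke)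
  show ?thesis
    unfolding jucys_murphy_def using assms
    by (intro finsum_closed Pi_I hecke_smult_in_carrier hecke_T_transpose_in_carrier) auto
qed

lemma (in hecke_module) act_finsum:
  assumes "finite A" "\<And>a. a \<in> A \<Longrightarrow> f a \<in> carrier (hecke n q)"
  shows "act (\<Oplus>\<^bsub>hecke n q\<^esub>a\<in>A. f a) x = (\<Sum>a\<in>A. act (f a) x)"
  using assms
proof (induction A)
  interpret H: ring "hecke n q" by (rule ring_hecke)
  case empty
  have "act \<zero>\<^bsub>hecke n q\<^esub> x = act \<zero>\<^bsub>hecke n q\<^esub> x + act \<zero>\<^bsub>hecke n q\<^esub> x"
    using act_add[of "\<zero>\<^bsub>hecke n q\<^esub>" "\<zero>\<^bsub>hecke n q\<^esub>"] by simp
  then show ?case by simp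
next
  interpret H: ring "hecke n q" by (rule ring_hecke)
  case (insert a A)
  then show ?case by (subst H.finsum_insert) (auto simp: act_add)
qed

lemma (in seminormal_module) eigenvalue_hecke_P:
  assumes "S \<in> SYT lam" and "k \<le> n - 1"
  shows "eigenvalue_at scale (act (hecke_P n k q)) (v S) (of_real (eig_tableau n k q S))"
proof -
  interpret H: ring "hecke n q" by (rule ring_hecke)
  have J: "jucys_murphy n q (n + 1 - l) \<in> carrier (hecke n q)" if "l \<in> {1..k}" for l
    using that by (intro jucys_murphy_in_carrier) auto
  let ?X = "\<Oplus>\<^bsub>hecke n q\<^esub>l\<in>{1..k}. jucys_murphy n q (n + 1 - l)"
  let ?c = "\<Sum>l=1..k. qint q (content S (n + 1 - l))"
  have "act ?X (v S)
      = (\<Sum>l=1..k. scale (of_real (qint q (content S (n + 1 - l)))) (v S))"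
    using assms by (subst act_finsum[OF _ J]) (auto intro!: sum.cong jucys_murphy_eigen)
  also have "\<dots> = scale (of_real ?c) (v S)"
    by (simp add: scale_sum_left)
  finally have sum: "act ?X (v S) = scale (of_real ?c) (v S)" .
  have "?X \<in> carrier (hecke n q)"
    using J by (intro H.finsum_closed) auto
  then have "act (hecke_P n k q) (v S) = scale (of_real (1 / qint q (int n))) (v S)
      + scale (of_real (coeff_P n k q)) (act ?X (v S))"
    unfolding hecke_P_def
    by (simp only: act_add act_smult hecke_smult_in_carrier act_one H.one_closed)
  also have "\<dots> = scale (of_real (eig_tableau n k q S)) (v S)"
    unfolding eig_tableau_def sum by (simp add: scale_left_distrib)
  finally have "act (hecke_P n k q) (v S) = scale (of_real (eig_tableau n k q S)) (v S)" .
  moreover have "v S \<noteq> 0"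
    using basis_independent assms(1) dependent_zero by fastforce
  ultimately show ?thesis by (simp add: eigenvalue_at_def)
qed


section \<open>The spectrum indexed by pairs of partitions\<close>

theorem theorem1p1:
  fixes n k :: nat and q :: real and lam :: "nat list"
    and scale :: "complex \<Rightarrow> 'v::ab_group_add \<Rightarrow> 'v"
    and act :: "free_elem set \<Rightarrow> 'v \<Rightarrow> 'v"
    and v :: "(nat \<times> nat \<Rightarrow> nat) \<Rightarrow> 'v"
  assumes "q > 1" and "1 \<le> k" and "k \<le> n - 1"
    and "lam \<in> partitions_of n"
    and "seminormal_module scale n q act lam v"
  shows "(\<forall>S\<in>SYT lam.
           eigenvalue_at scale (act (hecke_P n k q)) (v S) (of_real (eig_tableau n k q S)))
    \<and> (\<forall>S\<in>SYT lam. \<exists>!mu. mu \<in> partitions_of (n - k) \<and> diagram mu \<subseteq> diagram lam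
           \<and> assigned (n - k) S mu)
    \<and> (\<forall>S\<in>SYT lam. \<forall>mu\<in>partitions_of (n - k). assigned (n - k) S mu
           \<longrightarrow> eig_tableau n k q S = eig_pair n k q lam mu)
    \<and> eig_tableau n k q ` SYT lam
        = eig_pair n k q lam ` {mu \<in> partitions_of (n - k). diagram mu \<subseteq> diagram lam}
    \<and> (\<forall>mu\<in>partitions_of (n - k). diagram mu \<subseteq> diagram lam
           \<longrightarrow> pair_multiplicity n k v lam mu = num_SYT mu * num_skew_SYT lam mu)"
proof -
  interpret seminormal_module scale n q act lam v by fact
  have kn: "k \<le> n" using \<open>k \<le> n - 1\<close> by simp
  note ex1 = ex1_assigned[OF _ assms(4) diff_le_self, of _ k]
  note eig = eig_tableau_eq_eig_pair[OF _ assms(4) kn]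
  have "eig_tableau n k q ` SYT lam
        = eig_pair n k q lam ` {mu \<in> partitions_of (n - k). diagram mu \<subseteq> diagram lam}"
  proof (intro equalityI image_subsetI)
    fix S assume S: "S \<in> SYT lam"
    then show "eig_tableau n k q S \<in>
        eig_pair n k q lam ` {mu \<in> partitions_of (n - k). diagram mu \<subseteq> diagram lam}"
      using ex1[OF S] eig[OF S] by auto
  next
    fix mu assume "mu \<in> {mu \<in> partitions_of (n - k). diagram mu \<subseteq> diagram lam}"
    then obtain S where "S \<in> SYT lam" "assigned (n - k) S mu"
      using ex_tableau_assigned by blast
    then show "eig_pair n k q lam mu \<in> eig_tableau n k q ` SYT lam"
      using eig by (metis image_eqI)
  qed
  moreover have "pair_multiplicity n k v lam mu = num_SYT mu * num_skew_SYT lam mu"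
    if "mu \<in> partitions_of (n - k)" "diagram mu \<subseteq> diagram lam" for mu
  proof -
    have "{v S | S. S \<in> SYT lam \<and> assigned (n - k) S mu}
        = v ` {S \<in> SYT lam. assigned (n - k) S mu}" by auto
    moreover have "inj_on v {S \<in> SYT lam. assigned (n - k) S mu}"
      using basis_inj by (rule inj_on_subset) auto
    ultimately show ?thesis
      using card_tableaux_assigned[OF that] by (simp add: pair_multiplicity_def card_image)
  qed
  ultimately show ?thesis
    using eigenvalue_hecke_P[OF _ \<open>k \<le> n - 1\<close>] ex1 eig by blast
qed

end
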